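(* If $X$ is a Hamilton-decomposable graph, then the complete generalized truncation of $X$ is also Hamilton-decomposable.
   Context: Generalized truncation of a graph $X$ (without isolated vertices): take a matching $M_0$ with $|M_0|=|E(X)|$ (on $2|E(X)|$ new vertices) and a bijection $F:E(X)\to M_0$; for each edge $e$ of $X$ with ends $u,v$, label one end of $F(e)$ by $u$ and the other by $v$. For $v\in V(X)$, the cluster $\mathrm{cl}(v)$ is the set of vertices labelled $v$; insert a graph $\mathrm{con}(v)$ (constituent) on $\mathrm{cl}(v)$. The result $F(M_0)\cup\bigcup_v\mathrm{con}(v)$ is a generalized truncation; it is the complete generalized truncation if every constituent is a complete graph. A regular graph is Hamilton-decomposable if its edge set can be partitioned into Hamilton cycles when its valency is even, and into Hamilton cycles and a single perfect matching when its valency is odd. *)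

theory Defs
  imports Main "HOL-Library.Disjoint_Sets"
begin

text \<open>Graphs are finite, without loops or multiple edges: a vertex set together with a set of
  two-element edges.\<close>

definition simple_graph :: "'a set \<Rightarrow> 'a set set \<Rightarrow> bool" where
  "simple_graph V E \<longleftrightarrow> finite V \<and> (\<forall>e\<in>E. e \<subseteq> V \<and> card e = 2)"

definition complete_edges :: "'a set \<Rightarrow> 'a set set" where
  "complete_edges S = {e. e \<subseteq> S \<and> card e = 2}"

definition valency :: "'a set set \<Rightarrow> 'a \<Rightarrow> nat" where
  "valency E v = card {e \<in> E. v \<in> e}"

definition regular_graph :: "'a set \<Rightarrow> 'a set set \<Rightarrow> nat \<Rightarrow> bool" where
  "regular_graph V E k \<longleftrightarrow> simple_graph V E \<and> (\<forall>v\<in>V. valency E v = k)"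

definition perfect_matching :: "'a set \<Rightarrow> 'a set set \<Rightarrow> 'a set set \<Rightarrow> bool" where
  "perfect_matching V E M \<longleftrightarrow> M \<subseteq> E \<and> (\<forall>v\<in>V. \<exists>!e. e \<in> M \<and> v \<in> e)"

definition cycle_edges :: "'a list \<Rightarrow> 'a set set" where
  "cycle_edges vs = {{vs ! i, vs ! (Suc i mod length vs)} | i. i < length vs}"

definition hamilton_cycle :: "'a set \<Rightarrow> 'a set set \<Rightarrow> 'a set set \<Rightarrow> bool" where
  "hamilton_cycle V E C \<longleftrightarrow> C \<subseteq> E \<and>
     (\<exists>vs. distinct vs \<and> set vs = V \<and> length vs \<ge> 3 \<and> C = cycle_edges vs)"

definition hamilton_decomposable :: "'a set \<Rightarrow> 'a set set \<Rightarrow> bool" where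
  "hamilton_decomposable V E \<longleftrightarrow> (\<exists>k. regular_graph V E k \<and>
     (if even k
      then \<exists>H. partition_on E H \<and> (\<forall>C\<in>H. hamilton_cycle V E C)
      else \<exists>M H. perfect_matching V E M \<and> partition_on (E - M) H \<and>
             (\<forall>C\<in>H. hamilton_cycle V E C)))"

definition cluster :: "'b set \<Rightarrow> ('b \<Rightarrow> 'a) \<Rightarrow> 'a \<Rightarrow> 'b set" where
  "cluster W lab v = {w \<in> W. lab w = v}"

text \<open>\<open>(W, D)\<close> is the generalized truncation of \<open>(V, E)\<close> built from the matching \<open>M0\<close> on the
  vertex set \<open>W\<close>, the bijection \<open>F\<close>, the labelling \<open>lab\<close> and the constituents \<open>con v\<close>. That
  \<open>lab\<close> is a bijection from the ends of \<open>F e\<close> to the ends of \<open>e\<close> says that one end of \<open>F e\<close> is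
  labelled by one end of \<open>e\<close> and the other by the other.\<close>

definition generalized_truncation ::
  "'a set \<Rightarrow> 'a set set \<Rightarrow> 'b set set \<Rightarrow> ('a set \<Rightarrow> 'b set) \<Rightarrow> ('b \<Rightarrow> 'a) \<Rightarrow> ('a \<Rightarrow> 'b set set) \<Rightarrow>
     'b set \<Rightarrow> 'b set set \<Rightarrow> bool" where
  "generalized_truncation V E M0 F lab con W D \<longleftrightarrow>
     simple_graph V E \<and> (\<forall>v\<in>V. valency E v > 0) \<and>
     simple_graph W M0 \<and> perfect_matching W M0 M0 \<and>
     bij_betw F E M0 \<and>
     (\<forall>e\<in>E. bij_betw lab (F e) e) \<and>
     (\<forall>v\<in>V. simple_graph (cluster W lab v) (con v)) \<and>
     D = M0 \<union> (\<Union>v\<in>V. con v)"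

definition complete_generalized_truncation ::
  "'a set \<Rightarrow> 'a set set \<Rightarrow> 'b set \<Rightarrow> 'b set set \<Rightarrow> bool" where
  "complete_generalized_truncation V E W D \<longleftrightarrow>
     (\<exists>M0 F lab con. generalized_truncation V E M0 F lab con W D \<and>
        (\<forall>v\<in>V. con v = complete_edges (cluster W lab v)))"

text \<open>Every graph without isolated vertices has a complete generalized truncation, with the
  incident vertex-edge pairs as its vertices.\<close>

lemma complete_generalized_truncation_exists:
  fixes V :: "'a set"
  assumes G: "simple_graph V E" and iso: "\<forall>v\<in>V. valency E v > 0"
  shows "\<exists>(W :: ('a \<times> 'a set) set) D. complete_generalized_truncation V E W D"
proof -
  define W where "W = {(v, e). e \<in> E \<and> v \<in> e}"
  define F where "F = (\<lambda>e :: 'a set. (\<lambda>v. (v, e)) ` e)"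
  define con where "con = (\<lambda>v. complete_edges (cluster W fst v))"
  have sub: "e \<subseteq> V" "card e = 2" if "e \<in> E" for e
    using G that by (auto simp: simple_graph_def)
  have "E \<subseteq> Pow V" using sub by auto
  then have WV: "W \<subseteq> V \<times> Pow V" unfolding W_def by blast
  have finV: "finite V" using G by (simp add: simple_graph_def)
  have finW: "finite W" by (rule finite_subset[OF WV]) (simp add: finV)
  have card_F: "card (F e) = 2" if "e \<in> E" for e
    using sub(2)[OF that] by (simp add: F_def card_image inj_on_def)
  have "simple_graph W (F ` E)"
    using finW card_F by (auto simp: simple_graph_def W_def F_def)
  moreover have "perfect_matching W (F ` E) (F ` E)"
    unfolding perfect_matching_def by (auto simp: W_def F_def)
  moreover have "inj_on F E"
  proof (rule inj_onI)
    fix e e' assume "e \<in> E" "e' \<in> E" and eq: "F e = F e'"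
    have "fst ` F e = e" "fst ` F e' = e'" by (simp_all add: F_def image_image)
    then show "e = e'" using eq by metis
  qed
  then have "bij_betw F E (F ` E)" by (simp add: bij_betw_def)
  moreover have "bij_betw fst (F e) e" for e :: "'a set"
    by (auto simp: bij_betw_def F_def inj_on_def image_image)
  moreover have "simple_graph (cluster W fst v) (con v)" for v
    using finW by (auto simp: simple_graph_def con_def complete_edges_def cluster_def)
  ultimately have "generalized_truncation V E (F ` E) F fst con W (F ` E \<union> (\<Union>v\<in>V. con v))"
    using G iso by (simp add: generalized_truncation_def)
  then show ?thesis
    unfolding complete_generalized_truncation_def con_def by blast
qed

end

theory Submission
  imports Defs
begin

text \<open>
  Each Hamilton cycle \<open>C\<close> of \<open>X\<close> enters and leaves the cluster of a vertex \<open>v\<close> at two vertices of that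
  cluster. Replacing \<open>v\<close> by a Hamilton path of the constituent with these two ends lifts \<open>C\<close> to a
  Hamilton cycle of the truncation. The lifts partition the edges if, in every cluster, the paths
  partition the complete graph \<open>K\<^sub>n\<close>, up to a matching when \<open>n\<close> is odd. On the integers mod \<open>n\<close> such
  paths are Walecki's zigzags: the edges \<open>{x, y}\<close> with \<open>x + y \<equiv> 2i\<close> or \<open>x + y \<equiv> 2i + 1\<close> form a Hamilton
  path from \<open>i\<close> to \<open>i + \<lceil>n/2\<rceil>\<close>, for \<open>i < \<lfloor>n/2\<rfloor>\<close>. If \<open>n\<close> is odd, the remaining edges, those with
  \<open>x + y \<equiv> n - 1\<close>, are a matching that misses only \<open>\<lfloor>n/2\<rfloor>\<close>, the one vertex that is not an end of a
  path; it corresponds to the edge of the perfect matching of \<open>X\<close> at \<open>v\<close>. So these matchings and the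
  perfect matching of \<open>X\<close> together give a perfect matching of the truncation.
\<close>

section \<open>Zigzag Hamilton paths in complete graphs\<close>

definition path_edges :: "'a list \<Rightarrow> 'a set set" where
  "path_edges xs = {{xs ! j, xs ! Suc j} | j. Suc j < length xs}"

text \<open>The sequence 0, 1, -1, 2, -2, ..., in which the sums of neighbours are alternately 1 and
  0.\<close>

definition zigzag :: "nat \<Rightarrow> int" where
  "zigzag j = (if even j then - int (j div 2) else int (j div 2) + 1)"

definition zigzag_path :: "nat \<Rightarrow> int \<Rightarrow> int list" where
  "zigzag_path n i = map (\<lambda>j. (i + zigzag j) mod int n) [0..<n]"

text \<open>Halving merges the residues \<open>2i\<close> and \<open>2i + 1\<close> of the sum of
  the ends into the colour \<open>i\<close>. For odd \<open>n\<close> the largest residue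
  \<open>n - 1\<close> has no partner and is alone in the colour \<open>n div 2\<close>.\<close>

definition edge_colour :: "nat \<Rightarrow> int set \<Rightarrow> int" where
  "edge_colour n e = (\<Sum>e mod int n) div 2"

lemma zigzag_add_Suc: "zigzag j + zigzag (Suc j) = (if even j then 1 else 0)"
  by (auto simp: zigzag_def elim!: oddE)

text \<open>The terms number \<open>n - 1\<close> and \<open>n\<close> differ by exactly
  \<open>n\<close>. Thus a zigzag modulo \<open>n\<close> that is continued beyond its last vertex
  stands still there, which is what excludes a further neighbour at that end.\<close>

lemma zigzag_closes: "n > 0 \<Longrightarrow> zigzag n mod int n = zigzag (n - 1) mod int n"
proof -
  assume "n > 0"
  then obtain k where k: "n = Suc k" by (cases n) auto
  have "zigzag n = zigzag (n - 1) + int n \<or> zigzag n = zigzag (n - 1) - int n"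
    unfolding k by (cases "even k") (auto simp: zigzag_def elim!: oddE evenE)
  then show ?thesis by auto
qed

text \<open>The first \<open>n\<close> terms lie in an interval of \<open>n\<close> consecutive
  integers, so two of them that are congruent modulo \<open>n\<close> are equal.\<close>

lemma zigzag_mod_inj: "inj_on (\<lambda>j. (i + zigzag j) mod int n) {..<n}"
proof (rule inj_onI)
  fix j k assume jk: "j \<in> {..<n}" "k \<in> {..<n}"
    and eq: "(i + zigzag j) mod int n = (i + zigzag k) mod int n"
  have "int n dvd zigzag j - zigzag k"
    using eq by (simp add: mod_eq_dvd_iff)
  moreover have "\<bar>zigzag j - zigzag k\<bar> < int n"
    using jk by (auto simp: zigzag_def elim!: oddE evenE)
  ultimately have "zigzag j = zigzag k"
    using dvd_imp_le_int[of "zigzag j - zigzag k" "int n"] by fastforce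
  then show "j = k"
    by (auto simp: zigzag_def split: if_splits elim!: oddE evenE)
qed

lemma zigzag_path_distinct: "distinct (zigzag_path n i)"
  using zigzag_mod_inj[of i n] by (simp add: zigzag_path_def distinct_map atLeast0LessThan)

lemma zigzag_path_set: "set (zigzag_path n i) = {0..<int n}"
proof (rule card_subset_eq)
  show "set (zigzag_path n i) \<subseteq> {0..<int n}"
    by (auto simp: zigzag_path_def)
  show "card (set (zigzag_path n i)) = card {0..<int n}"
    using distinct_card[OF zigzag_path_distinct[of n i]] by (simp add: zigzag_path_def)
qed simp

lemma zigzag_path_hd: "0 \<le> i \<Longrightarrow> i < int n \<Longrightarrow> hd (zigzag_path n i) = i"
  by (auto simp: zigzag_path_def hd_map zigzag_def)

text \<open>The last term is \<open>n div 2\<close> for even \<open>n\<close> and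
  \<open>- (n div 2)\<close> for odd \<open>n\<close>; modulo \<open>n\<close> both are
  \<open>(n + 1) div 2\<close>. The bound on \<open>i\<close> keeps the sum below
  \<open>n\<close>.\<close>

lemma zigzag_path_last:
  assumes "0 \<le> i" "i < int (n div 2)"
  shows "last (zigzag_path n i) = i + int ((n + 1) div 2)"
proof -
  have n: "n > 0" using assms by (cases n) auto
  have "last (zigzag_path n i) = (i + zigzag (n - 1)) mod int n"
    using n by (simp add: zigzag_path_def last_map)
  also have "\<dots> = (i + int ((n + 1) div 2)) mod int n"
  proof (cases "even n")
    case True
    then have "zigzag (n - 1) = int ((n + 1) div 2)" using n by (auto simp: zigzag_def)
    then show ?thesis by simp
  next
    case False
    then obtain m where "n = 2 * m + 1" by (auto elim: oddE)
    then have "i + int ((n + 1) div 2) = i + zigzag (n - 1) + int n"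
      by (simp add: zigzag_def)
    then show ?thesis by (metis mod_add_self2)
  qed
  also have "\<dots> = i + int ((n + 1) div 2)"
    using assms by (intro mod_pos_pos_trivial) linarith+
  finally show ?thesis .
qed

text \<open>Neighbours on the path have sums \<open>2 * i + 1\<close> and \<open>2 * i\<close>
  alternately, which gives one inclusion. Conversely, a vertex and a sum determine the other end of
  an edge. Inside the path the two admissible sums lead to the two neighbours; at either end of the
  path one of them leads back to the vertex itself.\<close>

lemma path_edges_zigzag_path:
  assumes "0 \<le> i" "i < int (n div 2)"
  shows "path_edges (zigzag_path n i) = {e \<in> complete_edges {0..<int n}. edge_colour n e = i}"
proof -
  define p where "p j = (i + zigzag j) mod int n" for j
  have n: "n > 0" using assms by (cases n) auto
  have range: "0 \<le> p j" "p j < int n" for j using n by (auto simp: p_def)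
  have edges: "path_edges (zigzag_path n i) = {{p j, p (Suc j)} | j. Suc j < n}"
    unfolding path_edges_def zigzag_path_def p_def by (auto; force)
  have sum: "(p j + p (Suc j)) mod int n = 2 * i + (if even j then 1 else 0)" for j
  proof -
    have "(p j + p (Suc j)) mod int n = (2 * i + (zigzag j + zigzag (Suc j))) mod int n"
      unfolding p_def by (simp add: mod_add_eq algebra_simps)
    also have "\<dots> = 2 * i + (if even j then 1 else 0)"
      unfolding zigzag_add_Suc using assms by (intro mod_pos_pos_trivial) (cases "even j"; simp; linarith)+
    finally show ?thesis .
  qed
  have inj: "p j \<noteq> p (Suc j)" if "Suc j < n" for j
    using inj_onD[OF zigzag_mod_inj[of i n], of j "Suc j"] that by (auto simp: p_def)
  show ?thesis
  proof (intro set_eqI iffI)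
    fix e assume "e \<in> path_edges (zigzag_path n i)"
    then obtain j where j: "e = {p j, p (Suc j)}" "Suc j < n" by (auto simp: edges)
    then show "e \<in> {e \<in> complete_edges {0..<int n}. edge_colour n e = i}"
      using range inj[of j] sum[of j] by (auto simp: complete_edges_def edge_colour_def)
  next
    fix e assume e: "e \<in> {e \<in> complete_edges {0..<int n}. edge_colour n e = i}"
    then obtain x y where xy: "e = {x, y}" "x \<noteq> y" "0 \<le> x" "x < int n" "0 \<le> y" "y < int n"
      by (auto simp: complete_edges_def card_2_iff)
    have "((x + y) mod int n) div 2 = i" using e xy by (simp add: edge_colour_def)
    then have xysum: "(x + y) mod int n = 2 * i + 1 \<or> (x + y) mod int n = 2 * i" by linarith
    have "x \<in> set (zigzag_path n i)" using xy by (simp add: zigzag_path_set)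
    then obtain j where j: "x = p j" "j < n" by (auto simp: zigzag_path_def p_def)
    have unique: "y = z" if "(x + y) mod int n = (x + z) mod int n" "0 \<le> z" "z < int n" for z
    proof -
      have "y mod int n = z mod int n" using that(1) by (simp add: mod_eq_dvd_iff)
      then show ?thesis using xy that by simp
    qed
    have end_eq: "p n = p (n - 1)"
      using zigzag_closes[OF n] unfolding p_def by (metis mod_add_right_eq)
    \<comment> \<open>At the last vertex, where \<open>Suc j = n\<close>, \<open>end_eq\<close>
      turns the assumption into \<open>y = x\<close>, which is excluded.\<close>
    have succ: "e \<in> path_edges (zigzag_path n i)" if "y = p (Suc j)"
      using that j xy end_eq unfolding edges by (cases "Suc j = n") auto
    have prev: "e \<in> path_edges (zigzag_path n i)" if "y = p j'" "j = Suc j'" for j'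
      using that j xy unfolding edges by (auto simp: insert_commute)
    show "e \<in> path_edges (zigzag_path n i)"
    \<comment> \<open>The first case is the sum that \<open>x\<close> has with its successor; the
      other admissible sum is the one with its predecessor.\<close>
    proof (cases "(x + y) mod int n = 2 * i + (if even j then 1 else 0)")
      case True
      then show ?thesis using succ unique[of "p (Suc j)"] sum[of j] range j by simp
    next
      case False
      show ?thesis
      proof (cases j)
        case 0
        \<comment> \<open>The first vertex has no predecessor: the remaining sum
          \<open>2 * i\<close> would force \<open>y = i = x\<close>.\<close>
        have "p 0 = i" using assms by (simp add: p_def zigzag_def)
        then have "(x + y) mod int n = (x + i) mod int n"
          using False xysum 0 j assms by auto
        then show ?thesis using unique[of i] xy j 0 \<open>p 0 = i\<close> assms by auto
      next
        case (Suc j')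
        then have "(x + y) mod int n = (x + p j') mod int n"
          using False xysum sum[of j'] j by (auto simp: add.commute split: if_splits)
        then show ?thesis using prev unique[of "p j'"] range Suc by blast
      qed
    qed
  qed
qed

lemma edge_colour_bounds:
  assumes "n > 0"
  shows "0 \<le> edge_colour n e" "edge_colour n e \<le> int (n div 2)"
    "even n \<Longrightarrow> edge_colour n e < int (n div 2)"
proof -
  have "0 \<le> \<Sum>e mod int n" "\<Sum>e mod int n < int n" using assms by auto
  moreover have "t div 2 < int (n div 2)" if "even n" "t < int n" for t
    using that by (auto elim!: evenE)
  ultimately show "0 \<le> edge_colour n e" "edge_colour n e \<le> int (n div 2)"
    "even n \<Longrightarrow> edge_colour n e < int (n div 2)"
    unfolding edge_colour_def by (linarith, linarith, blast)
qed

text \<open>The colour \<open>m\<close> consists of the residue \<open>n - 1\<close> only. Sums of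
  two vertices are at most \<open>2n - 2\<close>, so the next integer with this residue,
  \<open>2n - 1\<close>, is out of reach and the congruence is an equality.\<close>

lemma last_colour_iff:
  assumes "n = 2 * m + 1" "0 \<le> x" "x < int n" "0 \<le> y" "y < int n" "x \<noteq> y"
  shows "edge_colour n {x, y} = int m \<longleftrightarrow> x + y = 2 * int m"
proof -
  have s: "\<Sum>{x,y} = x + y" using assms by simp
  have "(x + y) mod int n = (if x + y < int n then x + y else x + y - int n)"
  proof (cases "x + y < int n")
    case False
    have "(x + y) mod int n = (x + y - int n) mod int n" by simp
    also have "\<dots> = x + y - int n" using False assms by (intro mod_pos_pos_trivial) auto
    finally show ?thesis using False by simp
  qed (use assms in simp)
  moreover have "(x + y - int n) div 2 < int m" "x + y < int n \<Longrightarrow> (x + y) div 2 = int m \<longleftrightarrow> x + y = 2 * int m"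
    using assms by linarith+
  ultimately show ?thesis unfolding edge_colour_def s using assms(1) by auto
qed

section \<open>Transport to an arbitrary vertex set with prescribed path ends\<close>

lemma path_edges_map: "path_edges (map f xs) = (`) f ` path_edges xs"
  unfolding path_edges_def setcompr_eq_image image_image
  by (rule image_cong) auto

lemma complete_edges_image:
  assumes "bij_betw f A S"
  shows "complete_edges S = (`) f ` complete_edges A"
proof (intro equalityI subsetI)
  have inj: "inj_on f A" and S: "S = f ` A" using assms by (auto simp: bij_betw_def)
  fix e
  {
    assume e: "e \<in> complete_edges S"
    then obtain B where B: "B \<subseteq> A" "e = f ` B"
      unfolding S complete_edges_def by (auto simp: subset_image_iff)
    have "card B = 2"
      using e card_image[OF inj_on_subset[OF inj B(1)]] unfolding B(2) by (simp add: complete_edges_def)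
    then show "e \<in> (`) f ` complete_edges A" using B by (auto simp: complete_edges_def)
  }
  {
    assume "e \<in> (`) f ` complete_edges A"
    then show "e \<in> complete_edges S"
      unfolding S complete_edges_def
      using card_image[OF inj_on_subset[OF inj]] by auto
  }
qed

text \<open>The edges of the last colour pair each \<open>x\<close> with its mirror image
  \<open>2 * m - x\<close>. The only fixed point of this reflection is \<open>m\<close>.\<close>

lemma last_colour_matching:
  assumes n: "n = 2 * m + 1" and x: "0 \<le> x" "x < int n"
  defines "M \<equiv> {e \<in> complete_edges {0..<int n}. edge_colour n e = int m}"
  shows "x \<noteq> int m \<Longrightarrow> \<exists>!e. e \<in> M \<and> x \<in> e" and "x = int m \<Longrightarrow> e \<in> M \<Longrightarrow> x \<notin> e"
proof -
  have M: "e \<in> M \<and> x \<in> e \<longleftrightarrow> e = {x, 2 * int m - x} \<and> x \<noteq> int m" for e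
  proof
    assume e: "e \<in> M \<and> x \<in> e"
    then have "card e = 2" "e \<subseteq> {0..<int n}" "x \<in> e" by (auto simp: M_def complete_edges_def)
    moreover obtain y where "e = {x, y}" "x \<noteq> y"
      using \<open>card e = 2\<close> \<open>x \<in> e\<close> by (auto simp: card_2_iff)
    ultimately have y: "e = {x, y}" "x \<noteq> y" "0 \<le> y" "y < int n" by auto
    then have "x + y = 2 * int m" using e last_colour_iff[OF n x] by (auto simp: M_def)
    then show "e = {x, 2 * int m - x} \<and> x \<noteq> int m" using y by (auto simp: algebra_simps)
  next
    assume "e = {x, 2 * int m - x} \<and> x \<noteq> int m"
    then show "e \<in> M \<and> x \<in> e"
      using x n last_colour_iff[OF n x, of "2 * int m - x"]
      by (auto simp: M_def complete_edges_def)
  qed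
  show "x \<noteq> int m \<Longrightarrow> \<exists>!e. e \<in> M \<and> x \<in> e" unfolding M by simp
  show "x = int m \<Longrightarrow> e \<in> M \<Longrightarrow> x \<notin> e" using M by blast
qed

text \<open>A numbering of \<open>S\<close> under which the zigzag path from \<open>h c\<close> runs
  from \<open>a c\<close> to \<open>b c\<close>. The starts take the first \<open>n div 2\<close>
  places, the final vertices take the last \<open>n div 2\<close>, and for odd \<open>n\<close> the
  one remaining vertex takes the place in the middle.\<close>

lemma bij_betw_prescribed_ends:
  fixes S :: "'b set"
  assumes fin: "finite S" "finite I"
    and a: "inj_on a I" and b: "inj_on b I" and ab: "a ` I \<inter> b ` I = {}" "a ` I \<union> b ` I \<subseteq> S"
    and n: "card S = n" "n div 2 = card I"
  obtains f :: "int \<Rightarrow> 'b" and h where "bij_betw f {0..<int n} S" "bij_betw h I {0..<int (n div 2)}"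
    "\<And>c. c \<in> I \<Longrightarrow> f (h c) = a c" "\<And>c. c \<in> I \<Longrightarrow> f (h c + int ((n + 1) div 2)) = b c"
proof -
  define m q where "m = n div 2" and "q = (n + 1) div 2"
  have mq: "m \<le> q" "m + q = n" "q \<le> m + 1" unfolding m_def q_def by linarith+
  have "card I = card {0..<int m}" using n(2) by (simp add: m_def)
  then obtain h where h: "bij_betw h I {0..<int m}"
    using finite_same_card_bij[OF fin(2) finite_atLeastLessThan_int] by blast
  have gh: "inv_into I h (h c) = c" if "c \<in> I" for c
    using bij_betw_inv_into_left[OF h that] .
  have hI: "0 \<le> h c" "h c < int m" if "c \<in> I" for c using bij_betwE[OF h] that by auto
  have card_ab: "card (a ` I \<union> b ` I) = 2 * m"
    using card_Un_disjoint[of "a ` I" "b ` I"] fin ab(1) card_image[OF a] card_image[OF b] n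
    by (simp add: m_def)
  then have card_rest: "card (S - (a ` I \<union> b ` I)) = q - m"
    using card_Diff_subset[OF finite_subset[OF ab(2) fin(1)] ab(2)] n mq by simp
  then have "card (S - (a ` I \<union> b ` I)) \<le> Suc 0" using mq by simp
  then have "\<exists>w. S - (a ` I \<union> b ` I) \<subseteq> {w}"
    using fin(1) by (subst (asm) card_le_Suc0_iff_eq) (simp, blast)
  \<comment> \<open>For odd \<open>n\<close> this is the one vertex that is not an end. For even
    \<open>n\<close> nothing remains and \<open>w\<close> is arbitrary; then \<open>m = q\<close>,
    so no place is assigned to it.\<close>
  then obtain w where w: "S - (a ` I \<union> b ` I) \<subseteq> {w}" ..
  define f where "f x = (if x < int m then a (inv_into I h x)
    else if x < int q then w else b (inv_into I h (x - int q)))" for x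
  have fa: "f (h c) = a c" if "c \<in> I" for c using hI[OF that] gh[OF that] by (simp add: f_def)
  have fb: "f (h c + int q) = b c" if "c \<in> I" for c
    using hI[OF that] gh[OF that] mq by (simp add: f_def)
  \<comment> \<open>Surjectivity suffices, since both sides have \<open>n\<close> elements.\<close>
  have sub: "S \<subseteq> f ` {0..<int n}"
  proof
    fix s assume s: "s \<in> S"
    consider c where "c \<in> I" "s = a c" | c where "c \<in> I" "s = b c" | "s \<notin> a ` I \<union> b ` I" by blast
    then show "s \<in> f ` {0..<int n}"
    proof cases
      case 1
      then show ?thesis using hI[of c] mq fa[of c] by (intro image_eqI[of _ _ "h c"]) auto
    next
      case 2
      then show ?thesis using hI[of c] mq fb[of c] by (intro image_eqI[of _ _ "h c + int q"]) auto
    next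
      case 3
      then have "S - (a ` I \<union> b ` I) \<noteq> {}" using s by blast
      then have "m < q" using card_rest fin(1) by (metis card_0_eq finite_Diff zero_less_diff neq0_conv)
      moreover have "s = w" using 3 s w by blast
      ultimately show ?thesis using mq by (intro image_eqI[of _ _ "int m"]) (auto simp: f_def)
    qed
  qed
  have "card (f ` {0..<int n}) \<le> card S" using card_image_le[of "{0..<int n}" f] n by simp
  then have img: "f ` {0..<int n} = S" using card_seteq[OF _ sub] by simp
  then have "bij_betw f {0..<int n} S"
    using eq_card_imp_inj_on[of "{0..<int n}" f] n by (simp add: bij_betw_def)
  then show ?thesis using that h fa fb unfolding m_def q_def by blast
qed

text \<open>Made for a single cluster \<open>S\<close>: \<open>I\<close> will be the set of Hamilton
  cycles of the decomposition, \<open>a c\<close> and \<open>b c\<close> the vertices at which the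
  lift of \<open>c\<close> enters and leaves the cluster, and \<open>M\<close> the edges that the
  paths leave over.\<close>

definition hamilton_path_system ::
    "'b set \<Rightarrow> 'c set \<Rightarrow> ('c \<Rightarrow> 'b) \<Rightarrow> ('c \<Rightarrow> 'b) \<Rightarrow> ('c \<Rightarrow> 'b list) \<Rightarrow> 'b set set \<Rightarrow> bool" where
  "hamilton_path_system S I a b Q M \<longleftrightarrow>
     (\<forall>c\<in>I. distinct (Q c) \<and> set (Q c) = S \<and> hd (Q c) = a c \<and> last (Q c) = b c) \<and>
     disjoint_family_on (\<lambda>c. path_edges (Q c)) I \<and> (\<forall>c\<in>I. M \<inter> path_edges (Q c) = {}) \<and>
     complete_edges S = M \<union> (\<Union>c\<in>I. path_edges (Q c)) \<and>
     (even (card S) \<longrightarrow> M = {}) \<and>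
     (odd (card S) \<longrightarrow> (\<forall>s \<in> a ` I \<union> b ` I. \<exists>!e. e \<in> M \<and> s \<in> e) \<and>
       (\<forall>s \<in> S - (a ` I \<union> b ` I). \<forall>e\<in>M. s \<notin> e))"

lemma hamilton_path_systemD:
  assumes "hamilton_path_system S I a b Q M"
  shows "c \<in> I \<Longrightarrow> distinct (Q c) \<and> set (Q c) = S \<and> hd (Q c) = a c \<and> last (Q c) = b c"
    and "disjoint_family_on (\<lambda>c. path_edges (Q c)) I"
    and "c \<in> I \<Longrightarrow> M \<inter> path_edges (Q c) = {}"
    and "complete_edges S = M \<union> (\<Union>c\<in>I. path_edges (Q c))"
    and "even (card S) \<Longrightarrow> M = {}"
    and "odd (card S) \<Longrightarrow> s \<in> a ` I \<union> b ` I \<Longrightarrow> \<exists>!e. e \<in> M \<and> s \<in> e"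
    and "odd (card S) \<Longrightarrow> s \<in> S - (a ` I \<union> b ` I) \<Longrightarrow> e \<in> M \<Longrightarrow> s \<notin> e"
proof -
  note 1 = assms[unfolded hamilton_path_system_def]
  note 2 = 1[THEN conjunct2] note 3 = 2[THEN conjunct2] note 4 = 3[THEN conjunct2]
  note 5 = 4[THEN conjunct2] note 6 = 5[THEN conjunct2]
  show "c \<in> I \<Longrightarrow> distinct (Q c) \<and> set (Q c) = S \<and> hd (Q c) = a c \<and> last (Q c) = b c"
    by (rule 1[THEN conjunct1, THEN bspec])
  show "disjoint_family_on (\<lambda>c. path_edges (Q c)) I" by (rule 2[THEN conjunct1])
  show "c \<in> I \<Longrightarrow> M \<inter> path_edges (Q c) = {}" by (rule 3[THEN conjunct1, THEN bspec])
  show "complete_edges S = M \<union> (\<Union>c\<in>I. path_edges (Q c))" by (rule 4[THEN conjunct1])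
  show "even (card S) \<Longrightarrow> M = {}" by (rule 5[THEN conjunct1, THEN mp])
  show "odd (card S) \<Longrightarrow> s \<in> a ` I \<union> b ` I \<Longrightarrow> \<exists>!e. e \<in> M \<and> s \<in> e"
    by (rule 6[THEN mp, THEN conjunct1, THEN bspec])
  show "odd (card S) \<Longrightarrow> s \<in> S - (a ` I \<union> b ` I) \<Longrightarrow> e \<in> M \<Longrightarrow> s \<notin> e"
    by (rule 6[THEN mp, THEN conjunct2, THEN bspec, THEN bspec])
qed

text \<open>A numbering with the prescribed ends carries the colour classes on
  \<open>{0..<n}\<close> over to \<open>S\<close>. The colours below \<open>n div 2\<close> become
  the paths and the colour \<open>n div 2\<close> becomes \<open>M\<close>.\<close>

lemma complete_graph_hamilton_paths:
  fixes S :: "'b set"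
  assumes fin: "finite S" "finite I"
    and a: "inj_on a I" and b: "inj_on b I" and ab: "a ` I \<inter> b ` I = {}" "a ` I \<union> b ` I \<subseteq> S"
    and card: "card S div 2 = card I"
  shows "\<exists>Q M. hamilton_path_system S I a b Q M"
proof -
  define n where "n = card S"
  obtain f :: "int \<Rightarrow> 'b" and h where f: "bij_betw f {0..<int n} S" and h: "bij_betw h I {0..<int (n div 2)}"
    and fa: "\<And>c. c \<in> I \<Longrightarrow> f (h c) = a c" and fb: "\<And>c. c \<in> I \<Longrightarrow> f (h c + int ((n + 1) div 2)) = b c"
    by (rule bij_betw_prescribed_ends[OF fin a b ab n_def[symmetric] card[folded n_def]]) (rule that)
  define Q where "Q c = map f (zigzag_path n (h c))" for c
  define K where "K = complete_edges {0..<int n}"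
  define M where "M = (`) f ` {e \<in> K. edge_colour n e = int (n div 2)}"
  have inj: "inj_on f {0..<int n}" and S: "f ` {0..<int n} = S" using f by (auto simp: bij_betw_def)
  have hI: "0 \<le> h c" "h c < int (n div 2)" if "c \<in> I" for c using bij_betwE[OF h] that by auto
  have hinj: "c = d" if "h c = h d" "c \<in> I" "d \<in> I" for c d
    using h that by (auto simp: bij_betw_def inj_on_def)
  have hsurj: "\<exists>c\<in>I. h c = x" if "x \<in> {0..<int (n div 2)}" for x
    using that unfolding bij_betw_imp_surj_on[OF h, symmetric] by auto
  have Sx: "\<exists>x. 0 \<le> x \<and> x < int n \<and> s = f x" if "s \<in> S" for s
    using that unfolding S[symmetric] by auto
  have KS: "complete_edges S = (`) f ` K" unfolding K_def by (rule complete_edges_image[OF f])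
  \<comment> \<open>An edge of \<open>S\<close> comes from one edge on \<open>{0..<n}\<close> only,
    so it has a well-defined colour; the disjointness claims rest on this.\<close>
  have Kinj: "e = e'" if "f ` e = f ` e'" "e \<in> K" "e' \<in> K" for e e'
    using that inj_on_image_eq_iff[OF inj, of e e'] by (auto simp: K_def complete_edges_def)
  have PQ: "path_edges (Q c) = (`) f ` {e \<in> K. edge_colour n e = h c}" if "c \<in> I" for c
    unfolding Q_def path_edges_map path_edges_zigzag_path[OF hI[OF that]] K_def ..
  have npos: "n > 0" if "e \<in> K" for e
    using that by (cases n) (auto simp: K_def complete_edges_def)
  have 1: "distinct (Q c) \<and> set (Q c) = S \<and> hd (Q c) = a c \<and> last (Q c) = b c" if c: "c \<in> I" for c
  proof -
    have "zigzag_path n (h c) \<noteq> []" using hI[OF c] by (auto simp: zigzag_path_def)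
    moreover have "h c < int n" using hI[OF c] by linarith
    ultimately show ?thesis
      using hI[OF c] inj S fa[OF c] fb[OF c]
      by (simp add: Q_def distinct_map zigzag_path_distinct zigzag_path_set hd_map last_map
          zigzag_path_hd zigzag_path_last)
  qed
  have 2: "disjoint_family_on (\<lambda>c. path_edges (Q c)) I"
    unfolding disjoint_family_on_def
  proof (intro ballI impI equals0I)
    fix c d e assume cd: "c \<in> I" "d \<in> I" "c \<noteq> d" and "e \<in> path_edges (Q c) \<inter> path_edges (Q d)"
    then obtain x y where "x \<in> K" "y \<in> K" "f ` x = f ` y" "edge_colour n x = h c" "edge_colour n y = h d"
      by (auto simp: PQ)
    then show False using Kinj[of x y] hinj[of c d] cd by auto
  qed
  have 3: "M \<inter> path_edges (Q c) = {}" if c: "c \<in> I" for c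
  proof (rule equals0I)
    fix e assume "e \<in> M \<inter> path_edges (Q c)"
    then obtain x y where "x \<in> K" "y \<in> K" "f ` x = f ` y"
      "edge_colour n x = int (n div 2)" "edge_colour n y = h c"
      unfolding PQ[OF c] M_def by auto
    then show False using Kinj[of x y] hI(2)[OF c] by auto
  qed
  have 4: "complete_edges S = M \<union> (\<Union>c\<in>I. path_edges (Q c))"
  proof (intro equalityI subsetI)
    fix e assume "e \<in> complete_edges S"
    then obtain d where d: "d \<in> K" "e = f ` d" unfolding KS by blast
    show "e \<in> M \<union> (\<Union>c\<in>I. path_edges (Q c))"
    proof (cases "edge_colour n d = int (n div 2)")
      case True then show ?thesis using d by (auto simp: M_def)
    next
      case False
      then have "edge_colour n d \<in> {0..<int (n div 2)}"
        using edge_colour_bounds[OF npos[OF d(1)], of d] by auto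
      then obtain c where c: "c \<in> I" "h c = edge_colour n d" using hsurj by blast
      then have "e \<in> path_edges (Q c)" using d unfolding PQ[OF c(1)] by auto
      then show ?thesis using c by blast
    qed
  qed (auto simp: KS PQ M_def)
  have 5: "M = {}" if "even n"
  proof (rule equals0I)
    fix e assume "e \<in> M"
    then obtain d where "d \<in> K" "edge_colour n d = int (n div 2)" by (auto simp: M_def)
    then show False using edge_colour_bounds(3)[OF npos that, of d d] by simp
  qed
  have 6: "(\<forall>s \<in> a ` I \<union> b ` I. \<exists>!e. e \<in> M \<and> s \<in> e) \<and> (\<forall>s \<in> S - (a ` I \<union> b ` I). \<forall>e\<in>M. s \<notin> e)"
    if odd: "odd n"
  proof -
    obtain m where m: "n = 2 * m + 1" using odd by (auto elim: oddE)
    then have nm: "n div 2 = m" "(n + 1) div 2 = m + 1" by auto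
    let ?M = "{e \<in> K. edge_colour n e = int m}"
    have mem: "f x \<in> f ` e \<longleftrightarrow> x \<in> e" if "e \<in> K" "0 \<le> x" "x < int n" for e x
      using that inj_on_image_mem_iff[OF inj, of x e] by (auto simp: K_def complete_edges_def)
    \<comment> \<open>The starts have the numbers from 0 to \<open>m - 1\<close> and the final
      vertices those from \<open>m + 1\<close> to \<open>2 * m\<close>, so \<open>m\<close> alone is
      left out. It is also the vertex missed by the matching.\<close>
    have ends: "f x \<in> a ` I \<union> b ` I \<longleftrightarrow> x \<noteq> int m" if x: "0 \<le> x" "x < int n" for x
    proof
      assume "f x \<in> a ` I \<union> b ` I"
      then obtain c where c: "c \<in> I" "f x = f (h c) \<or> f x = f (h c + int (m + 1))"
        using fa fb unfolding nm by (metis UnE imageE)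
      then have "x = h c \<or> x = h c + int (m + 1)"
        using inj_onD[OF inj, of x "h c"] inj_onD[OF inj, of x "h c + int (m + 1)"] x hI[OF c(1)] m
        by auto
      then show "x \<noteq> int m" using hI[OF c(1)] nm by auto
    next
      assume "x \<noteq> int m"
      then consider "x \<in> {0..<int m}" | "x - int (m + 1) \<in> {0..<int m}"
        using x m by (cases "x < int m") auto
      then show "f x \<in> a ` I \<union> b ` I"
      proof cases
        case 1
        then obtain c where "c \<in> I" "h c = x" using hsurj unfolding nm by blast
        then show ?thesis using fa by auto
      next
        case 2
        then obtain c where "c \<in> I" "h c = x - int (m + 1)" using hsurj unfolding nm by blast
        then show ?thesis using fb[of c] nm by auto
      qed
    qed
    have M: "M = (`) f ` ?M" by (simp add: M_def nm)
    have A: "\<exists>!e. e \<in> M \<and> f x \<in> e" if x: "0 \<le> x" "x < int n" "x \<noteq> int m" for x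
    proof -
      from last_colour_matching(1)[OF m x] obtain e where e: "e \<in> ?M" "x \<in> e"
        and u: "\<And>d. d \<in> ?M \<Longrightarrow> x \<in> d \<Longrightarrow> d = e" unfolding K_def by blast
      show ?thesis
      proof (rule ex1I[of _ "f ` e"])
        show "f ` e \<in> M \<and> f x \<in> f ` e" using e by (auto simp: M)
        fix d assume "d \<in> M \<and> f x \<in> d"
        then obtain d' where "d' \<in> ?M" "d = f ` d'" "f x \<in> f ` d'" by (auto simp: M)
        then show "d = f ` e" using u[of d'] mem[of d' x] x by auto
      qed
    qed
    have B: "f x \<notin> e" if x: "0 \<le> x" "x < int n" "x = int m" and "e \<in> M" for x e
      using that(4) last_colour_matching(2)[OF m x] mem[OF _ x(1,2)] by (auto simp: M K_def)
    show ?thesis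
    proof (intro conjI ballI)
      fix s assume s: "s \<in> a ` I \<union> b ` I"
      then obtain x where "0 \<le> x" "x < int n" "s = f x" using ab(2) Sx[of s] by blast
      then show "\<exists>!e. e \<in> M \<and> s \<in> e" using A ends s by simp
    next
      fix s e assume s: "s \<in> S - (a ` I \<union> b ` I)" and e: "e \<in> M"
      then obtain x where "0 \<le> x" "x < int n" "s = f x" using Sx[of s] by blast
      then show "s \<notin> e" using B ends s e by blast
    qed
  qed
  from 1 have "\<forall>c\<in>I. distinct (Q c) \<and> set (Q c) = S \<and> hd (Q c) = a c \<and> last (Q c) = b c" ..
  moreover from 3 have "\<forall>c\<in>I. M \<inter> path_edges (Q c) = {}" ..
  moreover from 5 have "even (card S) \<longrightarrow> M = {}" unfolding n_def ..
  moreover from 6 have "odd (card S) \<longrightarrow> (\<forall>s \<in> a ` I \<union> b ` I. \<exists>!e. e \<in> M \<and> s \<in> e) \<and>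
      (\<forall>s \<in> S - (a ` I \<union> b ` I). \<forall>e\<in>M. s \<notin> e)" unfolding n_def ..
  moreover note 2 4
  ultimately show ?thesis
    unfolding hamilton_path_system_def by (intro exI[of _ Q] exI[of _ M] conjI)
qed

section \<open>Cyclic orders and valencies\<close>

text \<open>Ordered pairs of neighbours replace indices. They allow induction on lists and remember
  the direction in which an edge is traversed.\<close>

lemma path_edges_eq_zip: "path_edges xs = (\<lambda>(x, y). {x, y}) ` set (zip xs (tl xs))"
  unfolding path_edges_def set_zip by (fastforce simp: nth_tl)

lemma cycle_edges_eq_zip: "cycle_edges xs = (\<lambda>(x, y). {x, y}) ` set (zip xs (rotate1 xs))"
  unfolding cycle_edges_def set_zip by (fastforce simp: nth_rotate1)

lemma set_zip_snoc: "set (zip (x # xs) (xs @ [y])) = insert (last (x # xs), y) (set (zip (x # xs) xs))"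
  by (induction xs arbitrary: x) auto

lemma set_zip_rotate1:
  "xs \<noteq> [] \<Longrightarrow> set (zip xs (rotate1 xs)) = insert (last xs, hd xs) (set (zip xs (tl xs)))"
  by (cases xs) (simp_all add: set_zip_snoc del: zip_Cons_Cons)

section \<open>Edges of concatenated lists\<close>

lemma path_edges_append:
  "xs \<noteq> [] \<Longrightarrow> ys \<noteq> [] \<Longrightarrow>
    path_edges (xs @ ys) = insert {last xs, hd ys} (path_edges xs \<union> path_edges ys)"
proof (induction xs)
  case (Cons x xs)
  then show ?case
    by (cases xs; cases ys) (auto simp: path_edges_eq_zip)
qed simp

lemma path_edges_concat:
  assumes "\<And>v. v \<in> set vs \<Longrightarrow> P v \<noteq> []"
  shows "path_edges (concat (map P vs)) = (\<Union>v\<in>set vs. path_edges (P v)) \<union>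
    (\<lambda>(u, v). {last (P u), hd (P v)}) ` set (zip vs (tl vs))"
  using assms
proof (induction vs)
  case Nil
  then show ?case by (simp add: path_edges_def)
next
  case (Cons u vs)
  show ?case
  proof (cases vs)
    case Nil
    then show ?thesis by simp
  next
    case (Cons v ws)
    have ne: "P u \<noteq> []" "concat (map P vs) \<noteq> []" "hd (concat (map P vs)) = hd (P v)"
      using Cons.prems Cons by auto
    have IH: "path_edges (concat (map P vs)) = (\<Union>v\<in>set vs. path_edges (P v)) \<union>
      (\<lambda>(u, v). {last (P u), hd (P v)}) ` set (zip vs (tl vs))"
      using Cons.IH Cons.prems by simp
    have "path_edges (concat (map P (u # vs))) =
        insert {last (P u), hd (P v)} (path_edges (P u) \<union> path_edges (concat (map P vs)))"
      using path_edges_append[OF ne(1,2)] ne(3) by simp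
    then show ?thesis unfolding IH by (simp add: Cons) blast
  qed
qed

text \<open>Closing the concatenation adds one link, from the last block back to the first. This is
  the pair by which \<open>rotate1\<close> differs from \<open>tl\<close>.\<close>

lemma cycle_edges_concat:
  assumes "\<And>v. v \<in> set vs \<Longrightarrow> P v \<noteq> []" and "vs \<noteq> []"
  shows "cycle_edges (concat (map P vs)) = (\<Union>v\<in>set vs. path_edges (P v)) \<union>
    (\<lambda>(u, v). {last (P u), hd (P v)}) ` set (zip vs (rotate1 vs))"
proof -
  let ?L = "concat (map P vs)"
  have ne: "?L \<noteq> []" using assms by (cases vs) auto
  have hd: "hd ?L = hd (P (hd vs))" using assms by (cases vs) auto
  have last: "last ?L = last (P (last vs))"
    using assms by (cases vs rule: rev_cases) auto
  have "cycle_edges ?L = insert {last ?L, hd ?L} (path_edges ?L)"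
    by (simp add: cycle_edges_eq_zip path_edges_eq_zip set_zip_rotate1[OF ne])
  moreover have "path_edges ?L = (\<Union>v\<in>set vs. path_edges (P v)) \<union>
      (\<lambda>(u, v). {last (P u), hd (P v)}) ` set (zip vs (tl vs))"
    by (rule path_edges_concat) (rule assms(1))
  ultimately show ?thesis
    unfolding set_zip_rotate1[OF assms(2)] hd last by simp
qed

lemma length_concat_ge: "(\<And>v. v \<in> set vs \<Longrightarrow> P v \<noteq> []) \<Longrightarrow> length vs \<le> length (concat (map P vs))"
proof (induction vs)
  case (Cons v vs)
  then have "length (P v) \<ge> 1" by (simp add: Suc_le_eq)
  moreover have "length vs \<le> length (concat (map P vs))" using Cons by simp
  ultimately show ?case by simp
qed simp

lemma distinct_concat_map:
  assumes "distinct vs" "\<And>v. v \<in> set vs \<Longrightarrow> distinct (P v)" "disjoint_family_on (\<lambda>v. set (P v)) (set vs)"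
  shows "distinct (concat (map P vs))"
  using assms
proof (induction vs)
  case (Cons v vs)
  then show ?case by (auto simp: disjoint_family_on_def)
qed simp

section \<open>Hamilton cycles as cyclic successor functions\<close>

lemma cyclic_successor:
  assumes "distinct vs" "length vs \<ge> 3"
  obtains s where "bij_betw s (set vs) (set vs)"
    "set (zip vs (rotate1 vs)) = (\<lambda>v. (v, s v)) ` set vs"
    "\<And>v. v \<in> set vs \<Longrightarrow> s v \<noteq> v" "\<And>v. v \<in> set vs \<Longrightarrow> s (s v) \<noteq> v"
proof -
  let ?n = "length vs"
  \<comment> \<open>As \<open>vs\<close> is distinct, the zipped list is a lookup table that sends
    each entry to the next one around the cycle.\<close>
  define s where "s v = the (map_of (zip vs (rotate1 vs)) v)" for v
  have s: "s (vs ! i) = vs ! (Suc i mod ?n)" if "i < ?n" for i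
    using map_of_zip_nth[of vs "rotate1 vs" i] assms(1) that by (simp add: s_def nth_rotate1)
  have zip: "set (zip vs (rotate1 vs)) = (\<lambda>v. (v, s v)) ` set vs"
    unfolding set_zip by (force simp: s nth_rotate1 in_set_conv_nth)
  have "s ` set vs = snd ` set (zip vs (rotate1 vs))" unfolding zip image_image by simp
  also have "\<dots> = set vs" by (simp flip: set_map)
  finally have img: "s ` set vs = set vs" .
  then have "bij_betw s (set vs) (set vs)"
    using eq_card_imp_inj_on[of "set vs" s] by (simp add: bij_betw_def)
  moreover have "s v \<noteq> v \<and> s (s v) \<noteq> v" if "v \<in> set vs" for v
  proof -
    obtain i where i: "i < ?n" "v = vs ! i" using \<open>v \<in> set vs\<close> by (auto simp: in_set_conv_nth)
    have l: "Suc i mod ?n < ?n" "Suc (Suc i mod ?n) mod ?n < ?n"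
      using i by (auto intro!: mod_less_divisor)
    \<comment> \<open>Here the length must be at least 3: on two vertices, two steps return to the
      start.\<close>
    have "Suc i mod ?n \<noteq> i" "Suc (Suc i mod ?n) mod ?n \<noteq> i"
      using i assms(2) by (auto simp: mod_Suc)
    then show ?thesis using s[OF i(1)] s[OF l(1)] i l nth_eq_iff_index_eq[OF assms(1)] by simp
  qed
  ultimately show ?thesis using that zip by blast
qed

text \<open>A Hamilton cycle together with a direction. The direction tells the edge that enters a
  vertex from the edge that leaves it; the list gives the order in which the cluster paths are
  concatenated.\<close>

definition cyclic_order :: "'a set \<Rightarrow> 'a set set \<Rightarrow> 'a list \<Rightarrow> ('a \<Rightarrow> 'a) \<Rightarrow> bool" where
  "cyclic_order V C vs s \<longleftrightarrow> distinct vs \<and> set vs = V \<and> length vs \<ge> 3 \<and> bij_betw s V V \<and>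
     set (zip vs (rotate1 vs)) = (\<lambda>v. (v, s v)) ` V \<and> C = (\<lambda>v. {v, s v}) ` V \<and>
     (\<forall>v\<in>V. s v \<noteq> v \<and> s (s v) \<noteq> v)"

lemma hamilton_cycle_cyclic_order:
  assumes "hamilton_cycle V E C"
  shows "\<exists>vs s. cyclic_order V C vs s"
proof -
  obtain vs where vs: "distinct vs" "set vs = V" "length vs \<ge> 3" "C = cycle_edges vs"
    using assms by (auto simp: hamilton_cycle_def)
  obtain s where s: "bij_betw s V V" "set (zip vs (rotate1 vs)) = (\<lambda>v. (v, s v)) ` V"
    "\<And>v. v \<in> V \<Longrightarrow> s v \<noteq> v" "\<And>v. v \<in> V \<Longrightarrow> s (s v) \<noteq> v"
    using cyclic_successor[OF vs(1,3)] vs(2) by metis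
  have "C = (\<lambda>v. {v, s v}) ` V" unfolding vs(4) cycle_edges_eq_zip s(2) image_image by simp
  then have "cyclic_order V C vs s" using vs s unfolding cyclic_order_def by blast
  then show ?thesis by blast
qed

text \<open>An edge \<open>{u, s u}\<close> contains \<open>v\<close> only if \<open>u\<close> is
  \<open>v\<close> or its predecessor. The two edges could coincide only if the predecessor and the
  successor did, that is, if \<open>s (s v) = v\<close>.\<close>

lemma cyclic_order_edges_at:
  assumes "cyclic_order V C vs s" and v: "v \<in> V"
  shows "{e \<in> C. v \<in> e} = {{inv_into V s v, v}, {v, s v}}"
    and "{inv_into V s v, v} \<noteq> {v, s v}"
proof -
  let ?p = "inv_into V s"
  have s: "bij_betw s V V" "C = (\<lambda>v. {v, s v}) ` V" "s v \<noteq> v" "s (s v) \<noteq> v"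
    using assms by (auto simp: cyclic_order_def)
  have p: "?p v \<in> V" "s (?p v) = v"
    using s(1) v by (auto simp: bij_betw_def f_inv_into_f inv_into_into)
  have ps: "?p (s u) = u" if "u \<in> V" for u using bij_betw_inv_into_left[OF s(1) that] .
  show "{e \<in> C. v \<in> e} = {{?p v, v}, {v, s v}}"
    unfolding s(2) using p ps v by (auto intro: image_eqI[of _ _ "?p v"])
  show "{?p v, v} \<noteq> {v, s v}"
    using p s(3,4) by (auto simp: doubleton_eq_iff)
qed

section \<open>Valencies from decompositions\<close>

lemma valency_hamilton_cycle:
  assumes "hamilton_cycle V E C" "v \<in> V"
  shows "valency C v = 2"
proof -
  obtain vs s where "cyclic_order V C vs s"
    using hamilton_cycle_cyclic_order[OF assms(1)] by blast
  from cyclic_order_edges_at[OF this assms(2)] show ?thesis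
    by (simp add: valency_def)
qed

text \<open>Counts the edges at \<open>v\<close> class by class. Applied to \<open>X\<close> it
  yields the cluster sizes, applied to the truncation it yields regularity.\<close>

lemma valency_decomposition:
  assumes "finite E" "M \<subseteq> E" "partition_on (E - M) H" "\<And>C. C \<in> H \<Longrightarrow> valency C v = 2"
  shows "valency E v = valency M v + 2 * card H"
proof -
  let ?at = "\<lambda>A. {e \<in> A. v \<in> e}"
  have finH: "finite H" using finite_elements[OF _ assms(3)] assms(1) by simp
  have H: "\<Union>H = E - M" "disjoint H" using assms(3) by (auto simp: partition_on_def)
  have finC: "finite C" if "C \<in> H" for C
    using that H(1) assms(1) by (metis Union_upper finite_Diff finite_subset)
  have "?at E = ?at M \<union> (\<Union>C\<in>H. ?at C)" using H(1) assms(2) by blast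
  moreover have "?at M \<inter> (\<Union>C\<in>H. ?at C) = {}" using H(1) by blast
  moreover have "finite (?at M)" using finite_subset[OF assms(2,1)] by simp
  moreover have "finite (\<Union>C\<in>H. ?at C)" using finH finC by simp
  ultimately have "card (?at E) = card (?at M) + card (\<Union>C\<in>H. ?at C)"
    by (simp add: card_Un_disjoint)
  also have "card (\<Union>C\<in>H. ?at C) = (\<Sum>C\<in>H. card (?at C))"
    using H(2) finH finC by (intro card_UN_disjoint) (auto simp: disjoint_def)
  also have "\<dots> = 2 * card H" using assms(4) by (simp add: valency_def)
  finally show ?thesis by (simp add: valency_def)
qed

lemma valency_perfect_matching: "perfect_matching V E M \<Longrightarrow> v \<in> V \<Longrightarrow> valency M v = 1"
  unfolding perfect_matching_def valency_def by (metis (no_types, lifting) is_singletonI' is_singleton_altdef mem_Collect_eq empty_iff)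

section \<open>Lifting a decomposition to the truncation\<close>

text \<open>Each vertex \<open>v\<close> of a cycle is replaced by the path \<open>P v\<close>. The
  concatenation of these paths in the order \<open>vs\<close> is the new cycle; since no path is
  empty, it still has at least 3 vertices.\<close>

lemma hamilton_cycle_expand:
  assumes vs: "distinct vs" "set vs = V" "length vs \<ge> 3"
    and s: "set (zip vs (rotate1 vs)) = (\<lambda>v. (v, s v)) ` V"
    and P: "\<And>v. v \<in> V \<Longrightarrow> distinct (P v)" "\<And>v. v \<in> V \<Longrightarrow> P v \<noteq> []"
      "disjoint_family_on (\<lambda>v. set (P v)) V" "(\<Union>v\<in>V. set (P v)) = W"
    and A: "A = (\<Union>v\<in>V. path_edges (P v)) \<union> (\<lambda>v. {last (P v), hd (P (s v))}) ` V" "A \<subseteq> D"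
  shows "hamilton_cycle W D A"
proof -
  let ?L = "concat (map P vs)"
  have "distinct ?L" using distinct_concat_map[of vs P] vs P by blast
  moreover have "set ?L = W" using vs(2) P(4) by simp
  moreover have "length ?L \<ge> 3" using length_concat_ge[of vs P] vs P(2) by simp
  moreover have "cycle_edges ?L = A"
  proof -
    have "vs \<noteq> []" using vs(3) by auto
    then have "cycle_edges ?L = (\<Union>v\<in>V. path_edges (P v)) \<union>
        (\<lambda>(u, v). {last (P u), hd (P v)}) ` set (zip vs (rotate1 vs))"
      using cycle_edges_concat[of vs P] vs(2) P(2) by simp
    then show ?thesis unfolding s A(1) image_image by simp
  qed
  ultimately show ?thesis using A(2) unfolding hamilton_cycle_def by blast
qed

text \<open>Treats even and odd valency together: \<open>M\<close> is empty in the former case and a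
  perfect matching in the latter, and \<open>M'\<close> inherits this property.\<close>

lemma complete_truncation_decomposition:
  fixes V :: "'a set" and W :: "'b set"
  assumes gt: "generalized_truncation V E M0 F lab con W D"
    and con: "\<And>v. v \<in> V \<Longrightarrow> con v = complete_edges (cluster W lab v)"
    and M: "M \<subseteq> E" "M = {} \<or> perfect_matching V E M"
    and H: "partition_on (E - M) H" "\<And>C. C \<in> H \<Longrightarrow> hamilton_cycle V E C"
  shows "\<exists>M' H'. M' \<subseteq> D \<and> partition_on (D - M') H' \<and> (\<forall>C\<in>H'. hamilton_cycle W D C) \<and>
    (M = {} \<longrightarrow> M' = {}) \<and> (perfect_matching V E M \<longrightarrow> perfect_matching W D M')"
proof -
  let ?cl = "cluster W lab"
  define star where "star v = {e \<in> E. v \<in> e}" for v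
  \<comment> \<open>For an end \<open>v\<close> of an edge \<open>e\<close>, this is the end of
    \<open>F e\<close> with label \<open>v\<close>.\<close>
  define g where "g v e = inv_into (F e) lab v" for v e

  have E: "e \<subseteq> V" "card e = 2" if "e \<in> E" for e
    using gt that by (auto simp: generalized_truncation_def simple_graph_def)
  have "finite V" using gt by (auto simp: generalized_truncation_def simple_graph_def)
  then have finE: "finite E" using E(1) by (meson finite_Pow_iff finite_subset PowI subsetI)
  have finW: "finite W" and M0: "e \<in> M0 \<Longrightarrow> e \<subseteq> W" "e \<in> M0 \<Longrightarrow> card e = 2" for e
    using gt by (auto simp: generalized_truncation_def simple_graph_def)
  have M0_ex1: "\<exists>!e. e \<in> M0 \<and> w \<in> e" if "w \<in> W" for w
    using gt that by (auto simp: generalized_truncation_def perfect_matching_def)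
  have F: "inj_on F E" "F ` E = M0"
    using gt by (auto simp: generalized_truncation_def bij_betw_def)
  have lab: "bij_betw lab (F e) e" if "e \<in> E" for e
    using gt that by (auto simp: generalized_truncation_def)
  have D: "D = M0 \<union> (\<Union>v\<in>V. complete_edges (?cl v))"
    using gt con by (auto simp: generalized_truncation_def)
  have F_unique: "e = e'" if "e \<in> E" "e' \<in> E" "w \<in> F e" "w \<in> F e'" for e e' w
  proof -
    have "F e \<in> M0" "F e' \<in> M0" using F(2) that by auto
    then have "F e = F e'" using M0_ex1[of w] M0(1) that by blast
    then show ?thesis using inj_onD[OF F(1)] that by blast
  qed
  have g: "g v e \<in> F e" "lab (g v e) = v" if "e \<in> E" "v \<in> e" for e v
    using lab[OF that(1)] that(2) unfolding g_def bij_betw_def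
    by (auto simp: inv_into_into f_inv_into_f)
  have g_lab: "g (lab w) e = w" "lab w \<in> e" if "e \<in> E" "w \<in> F e" for e w
    using lab[OF that(1)] that(2) unfolding g_def bij_betw_def by auto
  have F_edge: "F {u, v} = {g u {u, v}, g v {u, v}}" if "{u, v} \<in> E" for u v
    using bij_betw_imp_surj_on[OF bij_betw_inv_into[OF lab[OF that]]] by (simp add: g_def)
  have cover: "\<exists>e\<in>E. w \<in> F e" if "w \<in> W" for w
    using M0_ex1[OF that] F(2) by blast
  have lab_V: "lab w \<in> V" if "w \<in> W" for w
    using cover[OF that] g_lab(2) E(1) by blast
  \<comment> \<open>By this and \<open>g_inj\<close> the cluster of \<open>v\<close> is a bijective
    copy of the set of edges at \<open>v\<close>, so its size is the valency of
    \<open>v\<close>.\<close>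
  have cl_star: "?cl v = g v ` star v" for v
  proof (intro equalityI subsetI)
    fix w assume "w \<in> ?cl v"
    then have w: "w \<in> W" "lab w = v" by (auto simp: cluster_def)
    then obtain e where "e \<in> E" "w \<in> F e" using cover by blast
    then show "w \<in> g v ` star v" using g_lab[of e w] w by (auto simp: star_def)
  next
    fix w assume "w \<in> g v ` star v"
    then obtain e where "e \<in> E" "v \<in> e" "w = g v e" by (auto simp: star_def)
    then show "w \<in> ?cl v" using g[of e v] M0(1)[of "F e"] F(2) by (auto simp: cluster_def)
  qed
  have g_inj: "inj_on (g v) (star v)" for v
  proof (rule inj_onI)
    fix e e' assume "e \<in> star v" "e' \<in> star v" "g v e = g v e'"
    then show "e = e'" using F_unique[of e e' "g v e"] g(1)[of e v] g(1)[of e' v] by (simp add: star_def)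
  qed
  have fin_cl: "finite (?cl v)" for v using finW by (simp add: cluster_def)
  have card_cl: "card (?cl v) = valency E v" for v
    unfolding cl_star card_image[OF g_inj] by (simp add: star_def valency_def)

  have HU: "\<Union>H = E - M" and Hdisj: "\<And>C C'. C \<in> H \<Longrightarrow> C' \<in> H \<Longrightarrow> C \<noteq> C' \<Longrightarrow> C \<inter> C' = {}"
    and Hne: "\<And>C. C \<in> H \<Longrightarrow> C \<noteq> {}"
    using H(1) by (auto simp: partition_on_def disjoint_def)
  have finH: "finite H" using finite_elements[OF _ H(1)] finE by simp
  have "\<exists>vs s. cyclic_order V C vs s" if "C \<in> H" for C
    using hamilton_cycle_cyclic_order[OF H(2)[OF that]] .
  then obtain vs s where ord: "\<And>C. C \<in> H \<Longrightarrow> cyclic_order V C (vs C) (s C)" by metis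
  have vs: "distinct (vs C)" "set (vs C) = V" "length (vs C) \<ge> 3"
    and s: "bij_betw (s C) V V" "set (zip (vs C) (rotate1 (vs C))) = (\<lambda>v. (v, s C v)) ` V"
      "C = (\<lambda>v. {v, s C v}) ` V" if "C \<in> H" for C
    using ord[OF that] by (auto simp: cyclic_order_def)
  \<comment> \<open>The edges by which the directed cycle \<open>C\<close> enters and leaves
    \<open>v\<close>.\<close>
  define ein where "ein v C = {inv_into V (s C) v, v}" for v C
  define eout where "eout v C = {v, s C v}" for v C
  have at: "{e \<in> C. v \<in> e} = {ein v C, eout v C}" "ein v C \<noteq> eout v C" if "C \<in> H" "v \<in> V" for C v
    using cyclic_order_edges_at[OF ord[OF that(1)] that(2)] unfolding ein_def eout_def .
  have in_C: "ein v C \<in> C" "eout v C \<in> C" if "C \<in> H" "v \<in> V" for C v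
    using at(1)[OF that] by auto
  have in_star: "ein v C \<in> star v" "eout v C \<in> star v" if "C \<in> H" "v \<in> V" for C v
    using at(1)[OF that] HU that by (auto simp: star_def)
  have star_M: "e \<in> M \<or> (\<exists>C\<in>H. e = ein v C \<or> e = eout v C)" if ev: "e \<in> star v" "v \<in> V" for e v
  proof (cases "e \<in> M")
    case False
    then have "e \<in> \<Union>H" using ev HU by (auto simp: star_def)
    then obtain C where "C \<in> H" "e \<in> C" by blast
    then show ?thesis using at(1)[of C v] ev by (auto simp: star_def)
  qed simp
  have same: "C = C'" if "C \<in> H" "C' \<in> H" "e \<in> C" "e \<in> C'" for C C' e
    using Hdisj that by blast

  define a where "a v C = g v (ein v C)" for v C
  define b where "b v C = g v (eout v C)" for v C
  have g_eq: "e = e'" if "g v e = g v e'" "e \<in> star v" "e' \<in> star v" for v e e'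
    using inj_onD[OF g_inj] that by blast
  have val: "valency E v = valency M v + 2 * card H" if "v \<in> V" for v
    by (rule valency_decomposition[OF finE M(1) H(1)]) (rule valency_hamilton_cycle[OF H(2) that])
  have val0: "valency E v = 2 * card H" if "v \<in> V" "M = {}" for v
    using val that by (simp add: valency_def)
  have val1: "valency E v = 1 + 2 * card H" if "v \<in> V" "perfect_matching V E M" for v
    using val[OF that(1)] valency_perfect_matching[OF that(2,1)] by simp
  have "\<exists>Q N. hamilton_path_system (?cl v) H (a v) (b v) Q N" if v: "v \<in> V" for v
  proof (rule complete_graph_hamilton_paths[OF fin_cl finH])
    show "inj_on (a v) H"
      unfolding a_def using g_eq in_star(1) in_C(1) same v by (intro inj_onI) metis
    show "inj_on (b v) H"
      unfolding b_def using g_eq in_star(2) in_C(2) same v by (intro inj_onI) metis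
    \<comment> \<open>If an entering edge of one cycle is a leaving edge of another, the two cycles
      share it and are equal; but a cycle enters and leaves \<open>v\<close> by different
      edges.\<close>
    show "a v ` H \<inter> b v ` H = {}"
    proof (rule equals0I)
      fix w assume "w \<in> a v ` H \<inter> b v ` H"
      then obtain C C' where C: "C \<in> H" "C' \<in> H" "a v C = b v C'" by auto
      then have "ein v C = eout v C'" using g_eq in_star v unfolding a_def b_def by blast
      moreover from this have "C = C'" using same[OF C(1,2) in_C(1)[OF C(1) v]] in_C(2)[OF C(2) v] by simp
      ultimately show False using at(2)[OF C(1) v] by simp
    qed
    show "a v ` H \<union> b v ` H \<subseteq> ?cl v"
      unfolding cl_star a_def b_def using in_star v by blast
    \<comment> \<open>The cluster has \<open>2 * card H\<close> vertices if \<open>M\<close> is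
      empty and one more if \<open>M\<close> is a perfect matching; integer division by 2 gives
      \<open>card H\<close> in both cases.\<close>
    show "card (?cl v) div 2 = card H"
      unfolding card_cl using M(2) val0[OF v] val1[OF v] by auto
  qed
  then obtain Q N where sys: "\<And>v. v \<in> V \<Longrightarrow> hamilton_path_system (?cl v) H (a v) (b v) (Q v) (N v)"
    by metis
  have Q: "distinct (Q v C)" "set (Q v C) = ?cl v" "hd (Q v C) = a v C" "last (Q v C) = b v C"
    and NQ: "N v \<inter> path_edges (Q v C) = {}" if "v \<in> V" "C \<in> H" for v C
    using hamilton_path_systemD(1,3)[OF sys[OF that(1)] that(2)] by auto
  note Qdisj = hamilton_path_systemD(2)[OF sys] and K = hamilton_path_systemD(4)[OF sys]
    and N0 = hamilton_path_systemD(5)[OF sys] and N1 = hamilton_path_systemD(6)[OF sys]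
    and N2 = hamilton_path_systemD(7)[OF sys]

  define lift where "lift C = F ` C \<union> (\<Union>v\<in>V. path_edges (Q v C))" for C
  define M' where "M' = F ` M \<union> (\<Union>v\<in>V. N v)"
  \<comment> \<open>An edge inside a cluster has a single label, while the two ends of
    \<open>F e\<close> have different ones. Hence membership in \<open>lift C\<close> and
    \<open>M'\<close> can be tested separately on the edges \<open>F e\<close> and in each
    cluster.\<close>
  have K_lab: "u = v" if "e \<in> complete_edges (?cl u)" "e \<in> complete_edges (?cl v)" for e u v
  proof -
    have "e \<noteq> {}" using that by (auto simp: complete_edges_def)
    then obtain w where "w \<in> e" by blast
    then show ?thesis using that by (auto simp: complete_edges_def cluster_def)
  qed
  have F_K: "F e \<notin> complete_edges (?cl v)" if "e \<in> E" for e v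
  proof
    assume "F e \<in> complete_edges (?cl v)"
    then have "lab ` F e \<subseteq> {v}" by (auto simp: complete_edges_def cluster_def)
    then have "e \<subseteq> {v}" using bij_betw_imp_surj_on[OF lab[OF that]] by simp
    then show False using E(2)[OF that] card_mono[of "{v}" e] by simp
  qed
  have sub_K: "N v \<subseteq> complete_edges (?cl v)" "C \<in> H \<Longrightarrow> path_edges (Q v C) \<subseteq> complete_edges (?cl v)"
    if "v \<in> V" for v C using K[OF that] by auto
  have H_E: "C \<subseteq> E" if "C \<in> H" for C using HU that by blast
  have F_image: "F e \<in> F ` A \<longleftrightarrow> e \<in> A" if "e \<in> E" "A \<subseteq> E" for e A
    using inj_on_image_mem_iff[OF F(1)] that by simp
  have lift_F: "F e \<in> lift C \<longleftrightarrow> e \<in> C" if "e \<in> E" "C \<in> H" for e C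
    using F_image[OF that(1) H_E[OF that(2)]] F_K[OF that(1)] sub_K(2)[OF _ that(2)]
    unfolding lift_def by blast
  have M'_F: "F e \<in> M' \<longleftrightarrow> e \<in> M" if "e \<in> E" for e
    using F_image[OF that M(1)] F_K[OF that] sub_K(1) unfolding M'_def by blast
  have lift_K: "e \<in> lift C \<longleftrightarrow> e \<in> path_edges (Q v C)"
    if "e \<in> complete_edges (?cl v)" "v \<in> V" "C \<in> H" for e v C
    using that F_K H_E[OF that(3)] K_lab[OF that(1)] sub_K(2)[OF _ that(3)] unfolding lift_def by blast
  have M'_K: "e \<in> M' \<longleftrightarrow> e \<in> N v" if "e \<in> complete_edges (?cl v)" "v \<in> V" for e v
    using that F_K M(1) K_lab[OF that(1)] sub_K(1) unfolding M'_def by blast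
  have lift_D: "lift C \<subseteq> D" if "C \<in> H" for C
    unfolding lift_def D using sub_K(2) H_E[OF that] F(2) that by blast
  have M'_D: "M' \<subseteq> D" unfolding M'_def D using sub_K(1) M(1) F(2) by blast
  have D_cases: "(\<exists>e\<in>E. d = F e) \<or> (\<exists>v\<in>V. d \<in> complete_edges (?cl v))" if "d \<in> D" for d
    using that F(2) unfolding D by blast

  \<comment> \<open>On the edges \<open>F e\<close> the claim is the partition of
    \<open>E - M\<close> by \<open>H\<close>; inside a cluster it is the partition given by its path
    system.\<close>
  have "partition_on (D - M') (lift ` H)"
  proof (rule partition_onI)
    show "\<Union>(lift ` H) = D - M'"
    proof (intro equalityI subsetI)
      fix d assume "d \<in> \<Union>(lift ` H)"
      then obtain C where C: "C \<in> H" "d \<in> lift C" by blast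
      then have dD: "d \<in> D" using lift_D by blast
      from D_cases[OF dD] have "d \<notin> M'"
      proof (elim disjE bexE)
        fix e assume "e \<in> E" "d = F e"
        then show ?thesis using lift_F[of e C] M'_F[of e] C HU by blast
      next
        fix v assume "v \<in> V" "d \<in> complete_edges (?cl v)"
        then show ?thesis using lift_K[of d v C] M'_K[of d v] C NQ[of v C] by blast
      qed
      then show "d \<in> D - M'" using dD by blast
    next
      fix d assume d: "d \<in> D - M'"
      then have "d \<in> D" by blast
      from D_cases[OF this] show "d \<in> \<Union>(lift ` H)"
      proof (elim disjE bexE)
        fix e assume e: "e \<in> E" "d = F e"
        then have "e \<in> \<Union>H" using d M'_F[of e] HU by blast
        then show ?thesis using lift_F[OF e(1)] e by blast
      next
        fix v assume v: "v \<in> V" "d \<in> complete_edges (?cl v)"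
        then show ?thesis using d M'_K[OF v(2,1)] K[OF v(1)] lift_K[OF v(2,1)] by blast
      qed
    qed
  next
    fix A B assume "A \<in> lift ` H" "B \<in> lift ` H" "A \<noteq> B"
    then obtain C C' where C: "C \<in> H" "C' \<in> H" "A = lift C" "B = lift C'" "C \<noteq> C'" by blast
    show "disjnt A B"
      unfolding disjnt_def
    proof (rule equals0I)
      fix d assume d: "d \<in> A \<inter> B"
      then have "d \<in> D" using lift_D C by blast
      from D_cases[OF this] show False
      proof (elim disjE bexE)
        fix e assume "e \<in> E" "d = F e"
        then show ?thesis using lift_F[of e C] lift_F[of e C'] C d Hdisj[OF C(1,2,5)] by blast
      next
        fix v assume v: "v \<in> V" "d \<in> complete_edges (?cl v)"
        have "path_edges (Q v C) \<inter> path_edges (Q v C') = {}"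
          using disjoint_family_onD[OF Qdisj[OF v(1)] C(1,2,5)] .
        then show ?thesis using lift_K[OF v(2,1) C(1)] lift_K[OF v(2,1) C(2)] C d by blast
      qed
    qed
  next
    show "{} \<notin> lift ` H" using Hne by (auto simp: lift_def)
  qed
  moreover have "hamilton_cycle W D (lift C)" if C: "C \<in> H" for C
  proof (rule hamilton_cycle_expand[where P = "\<lambda>v. Q v C" and s = "s C", OF vs(1)[OF C] vs(2)[OF C] vs(3)[OF C] s(2)[OF C]])
    fix v assume v: "v \<in> V"
    show "distinct (Q v C)" using Q(1) v C by blast
    have "?cl v \<noteq> {}" using in_star(1)[OF C v] unfolding cl_star by blast
    then show "Q v C \<noteq> []" using Q(2)[OF v C] by auto
  next
    show "disjoint_family_on (\<lambda>v. set (Q v C)) V"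
      using Q(2)[OF _ C] by (auto simp: disjoint_family_on_def cluster_def)
    show "(\<Union>v\<in>V. set (Q v C)) = W"
      using Q(2)[OF _ C] lab_V by (auto simp: cluster_def)
    \<comment> \<open>The path in the cluster of \<open>v\<close> ends on the edge
      \<open>{v, s C v}\<close>. The same edge enters \<open>s C v\<close>, so the next path starts
      at the other end of its image under \<open>F\<close>.\<close>
    have "F ` C = (\<lambda>v. {last (Q v C), hd (Q (s C v) C)}) ` V"
    proof -
      have "F {v, s C v} = {last (Q v C), hd (Q (s C v) C)}" if v: "v \<in> V" for v
      proof -
        have sv: "s C v \<in> V" using bij_betwE[OF s(1)[OF C]] v by blast
        have "{v, s C v} \<in> E" using in_C(2)[OF C v] H_E[OF C] by (auto simp: eout_def)
        moreover have "ein (s C v) C = {v, s C v}"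
          using bij_betw_inv_into_left[OF s(1)[OF C] v] by (simp add: ein_def)
        ultimately show ?thesis
          using F_edge[of v "s C v"] Q(4)[OF v C] Q(3)[OF sv C] by (simp add: a_def b_def eout_def)
      qed
      then show ?thesis by (subst s(3)[OF C]) (simp add: image_image)
    qed
    then show "lift C = (\<Union>v\<in>V. path_edges (Q v C)) \<union> (\<lambda>v. {last (Q v C), hd (Q (s C v) C)}) ` V"
      by (auto simp: lift_def)
    show "lift C \<subseteq> D" by (rule lift_D[OF C])
  qed
  \<comment> \<open>All clusters then have even size, so their paths leave no edge over.\<close>
  moreover have "M' = {}" if "M = {}"
    using that N0 card_cl val0 by (simp add: M'_def)
  moreover have "perfect_matching W D M'" if pm: "perfect_matching V E M"
    unfolding perfect_matching_def
  proof (intro conjI ballI)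
    fix w assume w: "w \<in> W"
    define v where "v = lab w"
    have v: "v \<in> V" using lab_V w by (simp add: v_def)
    have odd: "odd (card (?cl v))" using card_cl val1[OF v pm] by simp
    obtain e where e: "e \<in> E" "w \<in> F e" using cover[OF w] by blast
    have we: "w = g v e" and es: "e \<in> star v" using g_lab[OF e] e(1) by (auto simp: v_def star_def)
    have wcl: "w \<in> ?cl v" using w by (simp add: cluster_def v_def)
    \<comment> \<open>Only the image \<open>F e\<close> of one edge and the leftover edges of its
      own cluster can cover \<open>w\<close>.\<close>
    have at_w: "d \<in> M' \<and> w \<in> d \<longleftrightarrow> (d = F e \<and> e \<in> M) \<or> (d \<in> N v \<and> w \<in> d)" for d
    proof
      assume d: "d \<in> M' \<and> w \<in> d"
      then consider e' where "e' \<in> M" "d = F e'" | u where "u \<in> V" "d \<in> N u" unfolding M'_def by blast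
      then show "(d = F e \<and> e \<in> M) \<or> (d \<in> N v \<and> w \<in> d)"
      proof cases
        case 1
        then have "e' = e" using F_unique[of e' e w] d e M(1) by blast
        then show ?thesis using 1 by blast
      next
        case 2
        then have "w \<in> ?cl u" using sub_K(1)[of u] d by (auto simp: complete_edges_def)
        then show ?thesis using 2 d by (simp add: cluster_def v_def)
      qed
    qed (use e v in \<open>auto simp: M'_def\<close>)
    show "\<exists>!d. d \<in> M' \<and> w \<in> d"
    \<comment> \<open>If \<open>e\<close> is in \<open>M\<close>, then \<open>w\<close> is not an
      end of a path and the leftover edges miss it, so \<open>F e\<close> alone covers it. Otherwise
      \<open>e\<close> lies on a cycle, \<open>w\<close> is an end of a path, and exactly one
      leftover edge covers it.\<close>
    proof (cases "e \<in> M")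
      case True
      have "w \<notin> a v ` H \<union> b v ` H"
      proof
        assume "w \<in> a v ` H \<union> b v ` H"
        then obtain C where C: "C \<in> H" "g v e = g v (ein v C) \<or> g v e = g v (eout v C)"
          unfolding a_def b_def we by blast
        then have "e = ein v C \<or> e = eout v C" using g_eq[OF _ es] in_star[OF C(1) v] by blast
        then have "e \<in> C" using in_C[OF C(1) v] by blast
        then show False using True C(1) HU by blast
      qed
      then have "w \<notin> d" if "d \<in> N v" for d using N2[OF v odd] wcl that by blast
      then show ?thesis unfolding at_w using True by blast
    next
      case False
      then have "w \<in> a v ` H \<union> b v ` H"
        using star_M[OF es v] unfolding we a_def b_def by blast
      from N1[OF v odd this] show ?thesis unfolding at_w using False by simp
    qed
  qed (rule M'_D)
  ultimately show ?thesis
    using M'_D by (intro exI[of _ M'] exI[of _ "lift ` H"]) blast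
qed

theorem theorem5p4:
  fixes V :: "'a set" and E :: "'a set set" and W :: "'b set" and D :: "'b set set"
  assumes "hamilton_decomposable V E"
    and "complete_generalized_truncation V E W D"
  shows "hamilton_decomposable W D"
proof -
  obtain M0 F lab con where gt: "generalized_truncation V E M0 F lab con W D"
    and con: "\<And>v. v \<in> V \<Longrightarrow> con v = complete_edges (cluster W lab v)"
    using assms(2) unfolding complete_generalized_truncation_def by blast
  have D: "simple_graph W D"
    using gt con unfolding generalized_truncation_def simple_graph_def complete_edges_def cluster_def
    by blast
  then have "D \<subseteq> Pow W" "finite W" by (auto simp: simple_graph_def)
  then have finD: "finite D" by (meson finite_Pow_iff finite_subset)
  \<comment> \<open>Regularity of the truncation is read off from its decomposition: every vertex
    has two edges on each Hamilton cycle.\<close>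
  have valD: "valency D w = valency M' w + 2 * card H'"
    if "M' \<subseteq> D" "partition_on (D - M') H'" "\<And>C. C \<in> H' \<Longrightarrow> hamilton_cycle W D C" "w \<in> W" for M' H' w
    by (rule valency_decomposition[OF finD that(1,2)]) (rule valency_hamilton_cycle[OF that(3) that(4)])
  consider (even) H where "partition_on E H" "\<forall>C\<in>H. hamilton_cycle V E C"
    | (odd) M H where "perfect_matching V E M" "partition_on (E - M) H" "\<forall>C\<in>H. hamilton_cycle V E C"
    using assms(1) unfolding hamilton_decomposable_def by (auto split: if_splits)
  then show ?thesis
  proof cases
    case (even H)
    note H = even(1) even(2)[rule_format]
    \<comment> \<open>With \<open>M\<close> empty, \<open>M'\<close> is empty as well, so
      \<open>H'\<close> partitions the whole of \<open>D\<close>.\<close>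
    have "partition_on (E - {}) H" using H(1) by simp
    from complete_truncation_decomposition[OF gt con _ _ this H(2)]
    obtain H' where H': "partition_on D H'" "\<And>C. C \<in> H' \<Longrightarrow> hamilton_cycle W D C" by auto
    have "valency D w = 2 * card H'" if "w \<in> W" for w
      using valD[of "{}" H' w] H' that by (simp add: valency_def)
    then have "regular_graph W D (2 * card H')" using D by (simp add: regular_graph_def)
    then show ?thesis unfolding hamilton_decomposable_def using H'
      by (intro exI[of _ "2 * card H'"]) auto
  next
    case (odd M H)
    note M = odd(1) and H = odd(2) odd(3)[rule_format]
    have "M \<subseteq> E" using M by (simp add: perfect_matching_def)
    from complete_truncation_decomposition[OF gt con this _ H] M
    obtain M' H' where H': "M' \<subseteq> D" "perfect_matching W D M'" "partition_on (D - M') H'"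
      "\<And>C. C \<in> H' \<Longrightarrow> hamilton_cycle W D C" by blast
    have "valency D w = 2 * card H' + 1" if "w \<in> W" for w
      using valD[OF H'(1,3,4) that] valency_perfect_matching[OF H'(2) that] by simp
    then have "regular_graph W D (2 * card H' + 1)" using D by (simp add: regular_graph_def)
    then show ?thesis unfolding hamilton_decomposable_def using H'
      by (intro exI[of _ "2 * card H' + 1"]) auto
  qed
qed

end
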